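(* There exist a frame spectral measure $\mu$ on $\mathbb{R}$ with compact support $T$ and a frame spectrum $\Lambda\subset\mathbb{R}$ of $\mu$ such that $$\dim\Lambda>\dim_H T,$$ where $\dim\Lambda$ is the (upper) Beurling dimension of $\Lambda$ and $\dim_H T$ is the Hausdorff dimension of $T$. In other words, the following assertion is false: if $\mu$ is a frame spectral measure with frame spectrum $\Lambda$ and compact support $T$, then $\dim\Lambda\le\dim_H T$.
   Context: Frame spectral measure: a nonzero finite Borel measure $\mu$ on $\mathbb{R}$ is a frame spectral measure with frame spectrum $\Lambda$, where $\Lambda\subset\mathbb{R}$ is countable, if there are constants $0<A\le B<\infty$ such that for every $f\in L^2(\mu)$, $A\|f\|_{L^2(\mu)}^2\le \sum_{\lambda\in\Lambda}\left|\int f(x)e^{-2\pi i\lambda x}\,d\mu(x)\right|^2\le B\|f\|_{L^2(\mu)}^2$. Beurling dimension: for $r>0$ put $\mathfrak{D}_r^+(\Lambda)=\limsup_{h\to\infty}\sup_{x\in\mathbb{R}}\frac{\#(\Lambda\cap B(x,h))}{h^r}$, where $B(x,h)$ is the open interval $(x-h,x+h)$. Then $\dim\Lambda=\sup\{r>0:\mathfrak{D}_r^+(\Lambda)>0\}$ (with $\sup\emptyset=0$), or equivalently $\dim\Lambda=\inf\{r>0:\mathfrak{D}_r^+(\Lambda)<+\infty\}$. *)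

theory Defs
  imports "HOL-Analysis.Analysis"
begin

section \<open>Frame spectral measures\<close>

definition fourier_coeff :: "real measure \<Rightarrow> (real \<Rightarrow> complex) \<Rightarrow> real \<Rightarrow> complex" where
  "fourier_coeff M f l =
     (LINT x|M. f x * exp (- 2 * of_real pi * \<i> * of_real l * of_real x))"

text \<open>The frame sum is formed in \<^typ>\<open>ennreal\<close>, where every family is summable, so that the upper
  bound includes the convergence of the series.\<close>

definition frame_spectral_measure :: "real measure \<Rightarrow> real set \<Rightarrow> bool" where
  "frame_spectral_measure M \<Lambda> \<longleftrightarrow>
     sets M = sets borel \<and> finite_measure M \<and> emeasure M UNIV \<noteq> 0 \<and> countable \<Lambda> \<and>
     (\<exists>A B :: real. 0 < A \<and> A \<le> B \<and>
       (\<forall>f :: real \<Rightarrow> complex.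
          f \<in> borel_measurable M \<and> integrable M (\<lambda>x. (cmod (f x))\<^sup>2) \<longrightarrow>
          ennreal (A * (LINT x|M. (cmod (f x))\<^sup>2))
            \<le> (\<Sum>\<^sub>\<infinity>l\<in>\<Lambda>. ennreal ((cmod (fourier_coeff M f l))\<^sup>2)) \<and>
          (\<Sum>\<^sub>\<infinity>l\<in>\<Lambda>. ennreal ((cmod (fourier_coeff M f l))\<^sup>2))
            \<le> ennreal (B * (LINT x|M. (cmod (f x))\<^sup>2))))"

definition measure_support :: "'a::topological_space measure \<Rightarrow> 'a set" where
  "measure_support M = {x. \<forall>U. open U \<and> x \<in> U \<longrightarrow> 0 < emeasure M U}"

section \<open>Beurling dimension\<close>

text \<open>Cardinalities are taken with respect to the counting measure, since \<^const>\<open>card\<close> is \<open>0\<close> on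
  infinite sets.\<close>

definition upper_beurling_density :: "real \<Rightarrow> real set \<Rightarrow> ennreal" where
  "upper_beurling_density r \<Lambda> =
     Limsup at_top (\<lambda>h::real.
       SUP x::real. emeasure (count_space UNIV) (\<Lambda> \<inter> ball x h) / ennreal (h powr r))"

text \<open>The supremum of the empty set in \<^typ>\<open>ennreal\<close> is \<open>0\<close>.\<close>

definition beurling_dim :: "real set \<Rightarrow> ennreal" where
  "beurling_dim \<Lambda> = (SUP r \<in> {r. 0 < r \<and> 0 < upper_beurling_density r \<Lambda>}. ennreal r)"

section \<open>Hausdorff dimension\<close>

text \<open>Covering sets are required to be bounded because \<^const>\<open>diameter\<close> is only meaningful there.\<close>

definition hausdorff_premeasure :: "real \<Rightarrow> real \<Rightarrow> 'a::metric_space set \<Rightarrow> ennreal" where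
  "hausdorff_premeasure s \<delta> A =
     (INF U \<in> {U :: nat \<Rightarrow> 'a set.
                 A \<subseteq> (\<Union>i. U i) \<and> (\<forall>i. bounded (U i) \<and> diameter (U i) \<le> \<delta>)}.
        \<Sum>i. ennreal (diameter (U i) powr s))"

definition hausdorff_outer_measure :: "real \<Rightarrow> 'a::metric_space set \<Rightarrow> ennreal" where
  "hausdorff_outer_measure s A = (SUP \<delta> \<in> {0<..}. hausdorff_premeasure s \<delta> A)"

text \<open>Only exponents \<open>s > 0\<close> are used: this does not change the infimum, and it avoids the
  exponent \<open>0\<close>, for which \<open>0 powr 0 = 0\<close> would give the wrong value on singletons.\<close>

definition hausdorff_dim :: "'a::metric_space set \<Rightarrow> ennreal" where
  "hausdorff_dim A = (INF s \<in> {s. 0 < s \<and> hausdorff_outer_measure s A = 0}. ennreal s)"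

end

theory Submission
  imports Defs
begin

text \<open>The measure is the uniform measure on a Moran set whose construction alternates between long
  blocks of splitting and much longer gaps. Seen right after a gap the set is covered by few tiny
  intervals, which makes its Hausdorff dimension small (at most \<open>2/7\<close>), whereas the Beurling
  dimension of the spectrum, being an upper density, sees the scales right after a block, where
  it is at least \<open>1/2\<close>.

  For the frame inequality, the frequencies of level \<open>k\<close> are an exact spectrum of the uniform measure
  on the \<open>n\<close> points of level \<open>k\<close>, so there Parseval's identity holds. Because of the gaps, replacing a
  point of the set by its level \<open>k\<close> approximation changes each of the \<open>n\<close> exponentials by
  \<open>O(n\<^sup>-\<^sup>5)\<close> uniformly, so the frame sum over level \<open>k\<close> is the squared norm of the conditional
  expectation of \<open>f\<close> on the cells up to a small error. These conditional expectations converge to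
  \<open>f\<close> in \<open>L\<^sup>2\<close>.\<close>

section \<open>Cell counts, points, frequencies and the finite Parseval identity\<close>

definition chi :: "real \<Rightarrow> complex" where
  "chi u = cis (- 2 * pi * u)"

lemma chi_add: "chi (u + v) = chi u * chi v"
  by (simp add: chi_def cis_mult algebra_simps)

lemma norm_chi [simp]: "cmod (chi u) = 1"
  by (simp add: chi_def)

lemma chi_0 [simp]: "chi 0 = 1"
  by (simp add: chi_def)

lemma chi_Ints: "u \<in> \<int> \<Longrightarrow> chi u = 1"
proof -
  assume "u \<in> \<int>"
  then have "- u \<in> \<int>" by simp
  then show ?thesis
    using cis_multiple_2pi[of "- u"] by (simp add: chi_def mult.assoc)
qed

lemma chi_eq_1_iff: "chi u = 1 \<longleftrightarrow> u \<in> \<int>"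
proof
  assume "chi u = 1"
  then have "cos (2 * pi * u) = 1"
    by (simp add: chi_def complex_eq_iff)
  then obtain n :: int where "2 * pi * u = of_int n * 2 * pi"
    using cos_one_2pi_int by blast
  then have "u = of_int n" by simp
  then show "u \<in> \<int>" by simp
qed (rule chi_Ints)

lemma cnj_chi: "cnj (chi u) = chi (- u)"
  by (simp add: chi_def cis_cnj)

lemma chi_of_nat_mult: "chi (of_nat m * u) = chi u ^ m"
  unfolding chi_def Complex.DeMoivre by (simp add: mult_ac)

lemma fourier_coeff_chi: "fourier_coeff M f l = (LINT x|M. f x * chi (l * x))"
  unfolding fourier_coeff_def chi_def
  by (intro Bochner_Integration.integral_cong) (auto simp: cis_conv_exp mult_ac)

lemma borel_measurable_chi [measurable]: "chi \<in> borel_measurable borel"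
  unfolding chi_def[abs_def] by (intro borel_measurable_continuous_onI continuous_intros)

text \<open>Factoring out \<open>chi v\<close> leaves the distance from \<open>chi (u - v)\<close>
  to 1, a chord, which is no longer than the arc it spans.\<close>

lemma norm_chi_diff: "cmod (chi u - chi v) \<le> 2 * pi * \<bar>u - v\<bar>"
proof -
  have "chi u - chi v = chi v * (chi (u - v) - 1)"
    by (simp add: algebra_simps flip: chi_add)
  then have "cmod (chi u - chi v) = cmod (exp (\<i> * of_real (- 2 * pi * (u - v))) - 1)"
    by (simp only: norm_mult norm_chi) (simp add: chi_def cis_conv_exp)
  also have "\<dots> = 2 * \<bar>sin (- 2 * pi * (u - v) / 2)\<bar>"
    by (rule dist_exp_i_1)
  also have "\<dots> \<le> 2 * \<bar>- 2 * pi * (u - v) / 2\<bar>"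
    using abs_sin_le_one abs_sin_x_le_abs_x[of "- 2 * pi * (u - v) / 2"] by linarith
  finally show ?thesis by (simp add: abs_mult)
qed

text \<open>The summand is \<open>w ^ m\<close> for an \<open>N\<close>-th root of unity
  \<open>w\<close>, so this is a geometric sum. It vanishes unless \<open>w = 1\<close>, and
  \<open>w = 1\<close> forces \<open>d = d'\<close> because \<open>(d - d') / N\<close> has absolute
  value below 1.\<close>

lemma sum_roots_of_unity:
  assumes "N > 0" and "d < N" and "d' < N"
  shows "(\<Sum>m<N. chi (real m * real d / real N) * cnj (chi (real m * real d' / real N)))
       = (if d = d' then of_nat N else 0)"
proof -
  define w where "w = chi ((real d - real d') / real N)"
  have t: "chi (real m * real d / real N) * cnj (chi (real m * real d' / real N)) = w ^ m" for m
    by (simp add: w_def cnj_chi chi_of_nat_mult[symmetric] diff_divide_distrib algebra_simps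
        flip: chi_add)
  have wN: "w ^ N = 1"
    using \<open>N > 0\<close> by (simp add: w_def chi_of_nat_mult[symmetric] chi_Ints)
  show ?thesis
  proof (cases "d = d'")
    case True
    then show ?thesis unfolding t by (simp add: w_def)
  next
    case False
    have "w \<noteq> 1"
    proof
      assume "w = 1"
      then have "(real d - real d') / real N \<in> \<int>"
        by (simp add: w_def chi_eq_1_iff)
      moreover have "\<bar>(real d - real d') / real N\<bar> < 1"
        using assms by (simp add: abs_if field_simps)
      ultimately have "(real d - real d') / real N = 0"
        by (metis Ints_nonzero_abs_less1)
      then show False using False assms by simp
    qed
    then show ?thesis unfolding t using False wN by (simp add: geometric_sum)
  qed
qed

text \<open>Writing each squared modulus as \<open>z * cnj z\<close> and summing over
  \<open>m\<close> first leaves only the diagonal terms, by orthogonality of the columns.\<close>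

lemma dft_parseval:
  fixes b :: "nat \<Rightarrow> complex"
  assumes "N > 0"
  shows "(\<Sum>m<N. (cmod (\<Sum>d<N. b d * chi (real m * real d / real N)))\<^sup>2)
       = real N * (\<Sum>d<N. (cmod (b d))\<^sup>2)"
proof -
  let ?e = "\<lambda>m d. chi (real m * real d / real N)"
  have "complex_of_real (\<Sum>m<N. (cmod (\<Sum>d<N. b d * ?e m d))\<^sup>2)
      = (\<Sum>m<N. (\<Sum>d<N. b d * ?e m d) * cnj (\<Sum>d<N. b d * ?e m d))"
    by (simp only: of_real_sum complex_norm_square)
  also have "\<dots> = (\<Sum>m<N. \<Sum>d<N. \<Sum>d'<N. b d * cnj (b d') * (?e m d * cnj (?e m d')))"
    by (simp add: cnj_sum sum_product mult_ac)
  also have "\<dots> = (\<Sum>d<N. \<Sum>d'<N. \<Sum>m<N. b d * cnj (b d') * (?e m d * cnj (?e m d')))"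
    by (subst sum.swap, rule sum.cong[OF refl], rule sum.swap)
  also have "\<dots> = (\<Sum>d<N. \<Sum>d'<N. b d * cnj (b d') * (if d = d' then of_nat N else 0))"
    unfolding sum_distrib_left[symmetric]
    by (intro sum.cong refl) (simp only: sum_roots_of_unity[OF assms] lessThan_iff)
  also have "\<dots> = (\<Sum>d<N. b d * cnj (b d) * of_nat N)"
    by (intro sum.cong refl) (simp add: if_distrib sum.delta cong: if_cong)
  also have "\<dots> = complex_of_real (real N * (\<Sum>d<N. (cmod (b d))\<^sup>2))"
    by (simp only: of_real_mult of_real_sum complex_norm_square sum_distrib_left of_real_of_nat_eq mult_ac)
  finally show ?thesis by (simp only: of_real_eq_iff)
qed

text \<open>Level \<open>k\<close> has \<open>n = ncell k\<close> cells, and each of them splits into \<open>L = branch k = 2n\<^sup>7\<close> subcells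
  spaced by \<open>1/L\<^sup>2\<close>, that is, spread over a length of only \<open>1/L\<close>. The matching new frequencies are the
  multiples of \<open>L\<close> below \<open>L\<^sup>2\<close>. Since \<open>L\<close> times a point of level \<open>k\<close> is an integer, a new frequency
  sees only the new digit of a point.\<close>

fun ncell :: "nat \<Rightarrow> nat" where
  "ncell 0 = 1"
| "ncell (Suc k) = 2 * ncell k ^ 8"

definition branch :: "nat \<Rightarrow> nat" where
  "branch k = 2 * ncell k ^ 7"

fun pt :: "nat \<Rightarrow> nat \<Rightarrow> real" where
  "pt 0 j = 0"
| "pt (Suc k) j = pt k (j div branch k) + real (j mod branch k) / (real (branch k))\<^sup>2"

fun freq :: "nat \<Rightarrow> nat set" where
  "freq 0 = {0}"
| "freq (Suc k) = (\<lambda>(l, m). l + branch k * m) ` (freq k \<times> {..<branch k})"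

section \<open>Arithmetic of cell counts and frequencies\<close>

lemma ncell_pos [simp]: "0 < ncell k"
  by (induction k) auto

lemma branch_pos [simp]: "0 < branch k"
  by (simp add: branch_def)

lemma ncell_Suc: "ncell (Suc k) = ncell k * branch k"
  by (simp add: branch_def eval_nat_numeral distrib_left)

declare ncell.simps(2) [simp del]

text \<open>Clears the denominators \<open>(branch k)^2\<close> of the digits of level
  \<open>Suc k\<close>, so that the frequencies introduced at the following level do not see
  them.\<close>

lemma branch_square_dvd: "(branch k)\<^sup>2 dvd branch (Suc k)"
proof -
  have "(branch k)\<^sup>2 dvd branch k ^ 7" by (intro le_imp_power_dvd) simp
  also have "\<dots> dvd branch (Suc k)"
    by (simp add: branch_def[of "Suc k"] ncell_Suc power_mult_distrib)
  finally show ?thesis .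
qed

lemma branch_ge_2: "2 \<le> branch k"
  by (simp add: branch_def Suc_le_eq)

lemma ncell_sq_le_branch: "(ncell k)\<^sup>2 \<le> branch k"
proof -
  have "(ncell k)\<^sup>2 \<le> ncell k ^ 7" by (intro power_increasing) (auto simp: Suc_le_eq)
  then show ?thesis by (simp add: branch_def)
qed

lemma branch_Suc_ge: "2 * branch k \<le> branch (Suc k)"
proof -
  have "2 * branch k \<le> branch k * branch k" using branch_ge_2[of k] by simp
  also have "\<dots> \<le> branch (Suc k)"
    using dvd_imp_le[OF branch_square_dvd[of k]] by (simp add: power2_eq_square)
  finally show ?thesis .
qed

text \<open>Serves twice: as \<open>(ncell k)^2\<close> is at most \<open>branch k\<close>, old
  frequencies are remainders modulo \<open>branch k\<close>; and a frequency times the cell length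
  \<open>1 / ncell k ^ 7\<close> is at most \<open>1 / ncell k ^ 5\<close>.\<close>

lemma freq_less: "l \<in> freq k \<Longrightarrow> l < (ncell k)\<^sup>2"
proof (induction k arbitrary: l)
  case (Suc k)
  from Suc.prems obtain l' m where l: "l = l' + branch k * m" "l' \<in> freq k" "m < branch k"
    by auto
  have "l' < branch k" using Suc.IH[OF l(2)] ncell_sq_le_branch[of k] by linarith
  then have "l < branch k * (m + 1)" by (simp add: l(1))
  also have "\<dots> \<le> branch k * branch k" using l(3) by (intro mult_le_mono) auto
  also have "\<dots> \<le> (ncell k)\<^sup>2 * (branch k)\<^sup>2"
    by (simp add: power2_eq_square Suc_le_eq)
  finally show ?case by (simp add: ncell_Suc power_mult_distrib)
qed simp

lemma freq_less_branch: "l \<in> freq k \<Longrightarrow> l < branch k"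
  using freq_less[of l k] ncell_sq_le_branch[of k] by linarith

lemma finite_freq [simp]: "finite (freq k)"
  by (induction k) auto

text \<open>Since \<open>l < branch k\<close>, the pair \<open>(l, m)\<close> is recovered as
  remainder and quotient modulo \<open>branch k\<close>.\<close>

lemma inj_on_freq: "inj_on (\<lambda>(l, m). l + branch k * m) (freq k \<times> {..<branch k})"
proof (intro inj_onI, clarsimp)
  fix l m l' m'
  assume "l \<in> freq k" "l' \<in> freq k" and eq: "l + branch k * m = l' + branch k * m'"
  then have b: "l < branch k" "l' < branch k" by (auto intro: freq_less_branch)
  have "l = (l + branch k * m) mod branch k" "m = (l + branch k * m) div branch k"
    "l' = (l' + branch k * m') mod branch k" "m' = (l' + branch k * m') div branch k"
    using b by (auto simp: div_mult_self2)
  then show "l = l' \<and> m = m'" using eq by metis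
qed

lemma sum_freq_Suc: "sum g (freq (Suc k)) = (\<Sum>l\<in>freq k. \<Sum>m<branch k. g (l + branch k * m))"
  unfolding freq.simps sum.reindex[OF inj_on_freq] sum.cartesian_product
  by (intro sum.cong) auto

lemma freq_mono_Suc: "freq k \<subseteq> freq (Suc k)"
proof
  fix l assume "l \<in> freq k"
  then have "(l, 0) \<in> freq k \<times> {..<branch k}" by simp
  then show "l \<in> freq (Suc k)" unfolding freq.simps by (rule rev_image_eqI) simp
qed

lemma freq_mono: "k \<le> k' \<Longrightarrow> freq k \<subseteq> freq k'"
  by (rule lift_Suc_mono_le[of freq]) (rule freq_mono_Suc)

lemma card_freq: "card (freq k) = ncell k"
  by (induction k) (simp_all add: card_image[OF inj_on_freq] card_cartesian_product ncell_Suc)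

text \<open>Splits a cell index of the next level into the parent cell \<open>i\<close> and the
  digit \<open>d\<close>, the quotient and remainder used in \<open>pt\<close>.\<close>

lemma sum_lessThan_mult:
  fixes g :: "nat \<Rightarrow> 'a::comm_monoid_add"
  shows "sum g {..<n * N} = (\<Sum>i<n. \<Sum>d<N. g (i * N + d))"
proof -
  have "(\<Sum>d<N. g (i * N + d)) = sum g {i * N..<i * N + N}" for i
    by (simp add: sum.shift_bounds_nat_ivl[of g 0 "i * N" N, simplified] atLeast0LessThan add.commute)
  then show ?thesis using sum.nat_group[of g N n] by simp
qed

section \<open>Parseval's identity for points and frequencies\<close>

lemma pt_branch_Ints: "pt k j * real (branch k) \<in> \<int>"
proof (induction k arbitrary: j)
  case (Suc k)
  \<comment> \<open>Old points have denominator \<open>branch k\<close> and new digits have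
    denominator \<open>(branch k)^2\<close>; both divide \<open>branch (Suc k)\<close>.\<close>
  obtain q where q: "branch (Suc k) = (branch k)\<^sup>2 * q"
    using branch_square_dvd[of k] by blast
  have "pt (Suc k) j * real (branch (Suc k))
      = (pt k (j div branch k) * real (branch k)) * real (branch k * q)
        + real (j mod branch k) * real q"
    using branch_pos[of k] by (simp add: q field_simps power2_eq_square)
  then show ?case using Suc.IH by (metis Ints_add Ints_mult Ints_of_nat)
qed simp

text \<open>For a fixed old frequency \<open>l\<close>, the sum over \<open>m\<close> is a discrete
  Fourier transform in the digit \<open>d\<close>. What remains, for each fixed \<open>d\<close>, is
  the identity of the previous level for the coefficients \<open>a (i * N + d)\<close>, where
  \<open>N = branch k\<close>.\<close>

lemma pt_parseval:
  fixes a :: "nat \<Rightarrow> complex"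
  shows "(\<Sum>l\<in>freq k. (cmod (\<Sum>j<ncell k. a j * chi (real l * pt k j)))\<^sup>2)
       = real (ncell k) * (\<Sum>j<ncell k. (cmod (a j))\<^sup>2)"
proof (induction k arbitrary: a)
  case (Suc k)
  let ?N = "branch k"
  have in_pt: "(\<Sum>m<?N. (cmod (\<Sum>j<ncell (Suc k). a j * chi (real (l + ?N * m) * pt (Suc k) j)))\<^sup>2)
      = real ?N * (\<Sum>d<?N. (cmod (\<Sum>i<ncell k. a (i * ?N + d) * chi (real l * pt k i)))\<^sup>2)" for l
  proof -
    \<comment> \<open>The old frequency does interact with the digit, but only through the factor
      \<open>chi (l * d / N^2)\<close>. It is independent of \<open>i\<close> and has modulus 1, so
      it disappears from the norms.\<close>
    define b where "b d = chi (real l * real d / (real ?N)\<^sup>2)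
        * (\<Sum>i<ncell k. a (i * ?N + d) * chi (real l * pt k i))" for d
    have "(\<Sum>j<ncell (Suc k). a j * chi (real (l + ?N * m) * pt (Suc k) j))
        = (\<Sum>d<?N. b d * chi (real m * real d / real ?N))" for m
    proof -
      have *: "chi (real (l + ?N * m) * (pt k i + real d / (real ?N)\<^sup>2))
          = chi (real l * pt k i) * chi (real l * real d / (real ?N)\<^sup>2) * chi (real m * real d / real ?N)"
        for i d
      proof -
        \<comment> \<open>Of the four products, \<open>m * (pt k i * N)\<close> is an integer and
          drops out of the exponential.\<close>
        have "real (l + ?N * m) * (pt k i + real d / (real ?N)\<^sup>2)
            = real l * pt k i + real l * real d / (real ?N)\<^sup>2 + real m * real d / real ?N
              + real m * (pt k i * real ?N)"
          using branch_pos[of k] by (simp add: field_simps power2_eq_square)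
        moreover have "chi (real m * (pt k i * real ?N)) = 1"
          by (intro chi_Ints Ints_mult pt_branch_Ints) auto
        ultimately show ?thesis by (simp add: chi_add)
      qed
      have "(\<Sum>j<ncell (Suc k). a j * chi (real (l + ?N * m) * pt (Suc k) j))
          = (\<Sum>i<ncell k. \<Sum>d<?N. a (i * ?N + d)
              * chi (real (l + ?N * m) * (pt k i + real d / (real ?N)\<^sup>2)))"
        unfolding ncell_Suc sum_lessThan_mult by (intro sum.cong refl) simp
      also have "\<dots> = (\<Sum>d<?N. \<Sum>i<ncell k. a (i * ?N + d)
              * chi (real (l + ?N * m) * (pt k i + real d / (real ?N)\<^sup>2)))"
        by (rule sum.swap)
      also have "\<dots> = (\<Sum>d<?N. b d * chi (real m * real d / real ?N))"
        unfolding * b_def sum_distrib_left sum_distrib_right by (intro sum.cong refl) (simp add: mult_ac)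
      finally show ?thesis .
    qed
    moreover have "cmod (b d) = cmod (\<Sum>i<ncell k. a (i * ?N + d) * chi (real l * pt k i))" for d
      by (simp add: b_def norm_mult)
    ultimately show ?thesis by (simp add: dft_parseval)
  qed
  have "(\<Sum>l\<in>freq (Suc k). (cmod (\<Sum>j<ncell (Suc k). a j * chi (real l * pt (Suc k) j)))\<^sup>2)
      = (\<Sum>l\<in>freq k. real ?N * (\<Sum>d<?N. (cmod (\<Sum>i<ncell k. a (i * ?N + d) * chi (real l * pt k i)))\<^sup>2))"
    unfolding sum_freq_Suc in_pt ..
  also have "\<dots> = real ?N * (\<Sum>d<?N. \<Sum>l\<in>freq k. (cmod (\<Sum>i<ncell k. a (i * ?N + d) * chi (real l * pt k i)))\<^sup>2)"
    unfolding sum_distrib_left[symmetric] by (subst sum.swap) (rule refl)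
  also have "\<dots> = real ?N * (\<Sum>d<?N. real (ncell k) * (\<Sum>i<ncell k. (cmod (a (i * ?N + d)))\<^sup>2))"
    unfolding Suc.IH ..
  also have "\<dots> = real (ncell (Suc k)) * (\<Sum>i<ncell k. \<Sum>d<?N. (cmod (a (i * ?N + d)))\<^sup>2)"
    unfolding sum_distrib_left[symmetric] ncell_Suc by (subst sum.swap) simp
  finally show ?case unfolding ncell_Suc sum_lessThan_mult .
qed simp

section \<open>The Moran set and its measure\<close>

text \<open>The set is parametrized by \<open>t\<close> in \<open>[0,1)\<close>:
  \<open>approx_pt k t\<close> is the point of the level \<open>k\<close> cell into which
  \<open>t\<close> falls, and the limit \<open>moran\<close> carries Lebesgue measure to the uniform
  measure. Level \<open>k\<close> cells become intervals of length \<open>1 / ncell k\<close> in the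
  parameter.\<close>

definition approx_pt :: "nat \<Rightarrow> real \<Rightarrow> real" where
  "approx_pt k t = pt k (nat \<lfloor>t * real (ncell k)\<rfloor>)"

definition moran :: "real \<Rightarrow> real" where
  "moran t = lim (\<lambda>k. approx_pt k t)"

text \<open>Follows from \<lfloor>x / b\<rfloor> = \<lfloor>x\<rfloor> div b for a positive integer
  \<open>b\<close>: the quotient of a subcell index by \<open>branch k\<close> is the index of the
  parent cell.\<close>

lemma cell_index_Suc_div:
  assumes "0 \<le> t"
  shows "nat \<lfloor>t * real (ncell (Suc k))\<rfloor> div branch k = nat \<lfloor>t * real (ncell k)\<rfloor>"
proof -
  have "\<lfloor>t * real (ncell (Suc k))\<rfloor> div int (branch k) = \<lfloor>t * real (ncell k)\<rfloor>"
    using floor_divide_real_eq_div[of "int (branch k)" "t * real (ncell (Suc k))"]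
    by (simp add: ncell_Suc less_imp_neq[OF branch_pos, symmetric])
  then show ?thesis using assms
    by (metis nat_div_distrib nat_int mult_nonneg_nonneg of_nat_0_le_iff zero_le_floor)
qed

text \<open>The shifted upper bound \<open>approx_pt k t + 2 / branch k\<close> decreases, which gives the tail estimate
  without summing a series.\<close>

lemma approx_pt_Suc:
  assumes "0 \<le> t"
  shows "approx_pt k t \<le> approx_pt (Suc k) t"
    and "approx_pt (Suc k) t + 2 / real (branch (Suc k)) \<le> approx_pt k t + 2 / real (branch k)"
proof -
  define d where "d = nat \<lfloor>t * real (ncell (Suc k))\<rfloor> mod branch k"
  have eq: "approx_pt (Suc k) t = approx_pt k t + real d / (real (branch k))\<^sup>2"
    by (simp add: approx_pt_def d_def cell_index_Suc_div[OF assms])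
  then show "approx_pt k t \<le> approx_pt (Suc k) t" by simp
  have "real d / (real (branch k))\<^sup>2 \<le> real (branch k) / (real (branch k))\<^sup>2"
    by (intro divide_right_mono) (auto simp: d_def less_imp_le)
  also have "\<dots> = 1 / real (branch k)" by (simp add: power2_eq_square)
  finally have "real d / (real (branch k))\<^sup>2 \<le> 1 / real (branch k)" .
  \<comment> \<open>As \<open>branch\<close> at least doubles, \<open>2 / branch\<close> drops by at
    least \<open>1 / branch k\<close>, which pays for the added digit.\<close>
  moreover have "2 / real (branch (Suc k)) \<le> 2 / real (2 * branch k)"
    using branch_Suc_ge[of k] branch_pos[of k] by (intro divide_left_mono) (auto simp del: of_nat_mult)
  ultimately show "approx_pt (Suc k) t + 2 / real (branch (Suc k)) \<le> approx_pt k t + 2 / real (branch k)"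
    using eq by simp
qed

lemma approx_pt_tail:
  assumes "0 \<le> t"
  shows "approx_pt k t \<le> approx_pt (k + i) t"
    and "approx_pt (k + i) t + 2 / real (branch (k + i)) \<le> approx_pt k t + 2 / real (branch k)"
proof -
  show "approx_pt k t \<le> approx_pt (k + i) t"
    by (induction i) (auto intro: order_trans approx_pt_Suc(1)[OF assms])
  show "approx_pt (k + i) t + 2 / real (branch (k + i)) \<le> approx_pt k t + 2 / real (branch k)"
  proof (induction i)
    case (Suc i)
    then show ?case using approx_pt_Suc(2)[OF assms, of "k + i"] by simp
  qed simp
qed

lemma approx_pt_tendsto:
  assumes "0 \<le> t"
  shows "(\<lambda>k. approx_pt k t) \<longlonglongrightarrow> moran t"
proof -
  have "incseq (\<lambda>k. approx_pt k t)" by (intro incseq_SucI approx_pt_Suc assms)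
  moreover have "approx_pt k t \<le> 2 / real (branch 0)" for k
    using approx_pt_tail(2)[OF assms, of 0 k]
    by (simp add: approx_pt_def) (smt (verit) divide_nonneg_nonneg of_nat_0_le_iff)
  ultimately have "convergent (\<lambda>k. approx_pt k t)"
    by (metis incseq_convergent convergentI)
  then show ?thesis by (simp add: moran_def convergent_LIMSEQ_iff)
qed

lemma moran_bounds:
  assumes "0 \<le> t"
  shows "approx_pt k t \<le> moran t" and "moran t \<le> approx_pt k t + 2 / real (branch k)"
proof -
  have l: "(\<lambda>i. approx_pt (k + i) t) \<longlonglongrightarrow> moran t"
    using LIMSEQ_ignore_initial_segment[OF approx_pt_tendsto[OF assms], of k] by (simp add: add.commute)
  show "approx_pt k t \<le> moran t"
    by (rule LIMSEQ_le_const[OF l]) (use approx_pt_tail(1)[OF assms] in auto)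
  have "approx_pt (k + i) t \<le> approx_pt k t + 2 / real (branch k)" for i
    using approx_pt_tail(2)[OF assms, of k i]
    by (smt (verit) divide_nonneg_nonneg of_nat_0_le_iff)
  then show "moran t \<le> approx_pt k t + 2 / real (branch k)"
    by (intro LIMSEQ_le_const2[OF l]) auto
qed

lemma borel_measurable_approx_pt [measurable]: "approx_pt k \<in> borel_measurable borel"
  unfolding approx_pt_def[abs_def] by measurable

lemma borel_measurable_moran [measurable]: "moran \<in> borel_measurable borel"
  unfolding moran_def[abs_def] by (intro borel_measurable_lim_metric borel_measurable_approx_pt)

section \<open>The uniform measure and its support\<close>

abbreviation unit_lborel :: "real measure" where
  "unit_lborel \<equiv> restrict_space lborel {0..<1}"

definition moran_measure :: "real measure" where
  "moran_measure = distr unit_lborel borel moran"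

lemma unit_lborel_measurable [measurable_cong]:
  "sets unit_lborel = sets (restrict_space borel {0..<1})"
  by (rule sets_restrict_space_cong) simp

lemma space_unit_lborel [simp]: "space unit_lborel = {0..<1}"
  by (simp add: space_restrict_space)

lemma emeasure_unit_lborel_space [simp]: "emeasure unit_lborel {0..<1} = 1"
  by (simp add: emeasure_restrict_space)

lemma finite_measure_unit_lborel: "finite_measure unit_lborel"
  by (rule finite_measureI) simp

lemma measurable_unit_lborel: "f \<in> borel_measurable borel \<Longrightarrow> f \<in> borel_measurable unit_lborel"
  by (intro measurable_restrict_space1) simp

lemma cell_index_less: "t \<in> {0..<1} \<Longrightarrow> nat \<lfloor>t * real (ncell k)\<rfloor> < ncell k"
proof -
  assume t: "t \<in> {0..<1}"
  have "t * real (ncell k) < real (ncell k)" using t by simp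
  then have "\<lfloor>t * real (ncell k)\<rfloor> < int (ncell k)" by (simp add: floor_less_iff)
  then show ?thesis using t by (subst nat_less_iff) auto
qed

definition cover_seg :: "nat \<Rightarrow> nat \<Rightarrow> real set" where
  "cover_seg k j = {pt k j .. pt k j + 2 / real (branch k)}"

lemma measure_support_closed: "closed (measure_support M)"
proof -
  have "- measure_support M = \<Union>{U. open U \<and> emeasure M U = 0}"
    by (auto simp: measure_support_def zero_less_iff_neq_zero)
  then have "open (- measure_support M)" by (auto simp: open_Union)
  then show ?thesis by (simp add: closed_def)
qed

text \<open>The finite union of segments is closed and contains every \<open>moran t\<close>, so its
  complement is an open null set.\<close>

lemma moran_measure_support_subset: "measure_support moran_measure \<subseteq> (\<Union>j<ncell k. cover_seg k j)"
proof
  fix x assume x: "x \<in> measure_support moran_measure"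
  let ?K = "\<Union>j<ncell k. cover_seg k j"
  have cl: "closed ?K" unfolding cover_seg_def by (intro closed_UN) auto
  have "moran t \<in> ?K" if t: "t \<in> {0..<1}" for t
    using cell_index_less[OF t, of k] moran_bounds[of t k] t
    by (auto simp: cover_seg_def approx_pt_def)
  then have e: "moran -` (- ?K) \<inter> {0..<1} = {}" by blast
  have "emeasure moran_measure (- ?K) = emeasure unit_lborel (moran -` (- ?K) \<inter> space unit_lborel)"
    unfolding moran_measure_def
    by (rule emeasure_distr[OF measurable_unit_lborel[OF borel_measurable_moran]])
      (use cl in \<open>blast intro: borel_closed borel_comp\<close>)
  also have "\<dots> = 0" using e by simp
  finally have "emeasure moran_measure (- ?K) = 0" .
  then show "x \<in> ?K" using x cl unfolding measure_support_def
    by (metis (mono_tags, lifting) ComplI less_irrefl mem_Collect_eq open_Compl)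
qed

lemma compact_moran_measure_support: "compact (measure_support moran_measure)"
proof -
  have "bounded (\<Union>j<ncell 0. cover_seg 0 j)" by (auto simp: cover_seg_def)
  then have "bounded (measure_support moran_measure)"
    using moran_measure_support_subset bounded_subset by blast
  then show ?thesis using measure_support_closed compact_eq_bounded_closed by blast
qed

section \<open>Dimensions\<close>

definition moran_spectrum :: "real set" where
  "moran_spectrum = real ` (\<Union>k. freq k)"

section \<open>Hausdorff dimension of the support\<close>

lemma ncell_ge: "Suc k \<le> ncell k"
proof (induction k)
  case (Suc k)
  have "Suc (Suc k) \<le> Suc k * 2" by simp
  also have "\<dots> \<le> ncell k * branch k" by (intro mult_le_mono Suc branch_ge_2)
  finally show ?case by (simp add: ncell_Suc)
qed simp

lemma ncell_inverse_tendsto: "(\<lambda>k. 1 / real (ncell k)) \<longlonglongrightarrow> 0"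
proof (rule tendsto_sandwich[where f = "\<lambda>_. 0" and h = "\<lambda>k. 1 / real (Suc k)"])
  show "(\<lambda>k. 1 / real (Suc k)) \<longlonglongrightarrow> 0"
    using LIMSEQ_inverse_real_of_nat by (simp only: inverse_eq_divide)
  show "\<forall>\<^sub>F k in sequentially. 1 / real (ncell k) \<le> 1 / real (Suc k)"
    by (intro always_eventually allI divide_left_mono) (use ncell_ge in \<open>auto simp del: of_nat_Suc\<close>)
qed auto

lemma diameter_cover_seg: "diameter (cover_seg k j) = 1 / real (ncell k) ^ 7"
  by (simp add: cover_seg_def diameter_closed_interval branch_def)

text \<open>Write \<open>n = ncell k\<close>. The \<open>n\<close> segments of length
  \<open>1 / n ^ 7\<close> contribute \<open>1 / n^2\<close> each at exponent \<open>2/7\<close>, in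
  total \<open>1 / n\<close>, which tends to 0.\<close>

lemma hausdorff_outer_measure_moran_support:
  "hausdorff_outer_measure (2/7) (measure_support moran_measure) = 0"
proof -
  have "hausdorff_premeasure (2/7) \<delta> (measure_support moran_measure) = 0" if "0 < \<delta>" for \<delta>
  proof -
    have le: "hausdorff_premeasure (2/7) \<delta> (measure_support moran_measure) \<le> ennreal (1 / real (ncell k))"
      if k: "1 / real (ncell k) < \<delta>" for k
    proof -
      let ?n = "real (ncell k)"
      \<comment> \<open>The cover must be an infinite sequence; it is padded with empty sets, whose
        diameter 0 contributes \<open>0 powr (2/7) = 0\<close>.\<close>
      define U where "U i = (if i < ncell k then cover_seg k i else {})" for i
      have n1: "1 \<le> ?n" by (simp add: Suc_le_eq)
      then have "1 / ?n ^ 7 \<le> 1 / ?n ^ 1" by (intro divide_left_mono power_increasing) auto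
      then have small: "1 / ?n ^ 7 \<le> \<delta>" using k by simp
      have "measure_support moran_measure \<subseteq> (\<Union>i. U i)"
        using moran_measure_support_subset[of k] by (fastforce simp: U_def)
      moreover have "bounded (U i) \<and> diameter (U i) \<le> \<delta>" for i
        using small \<open>0 < \<delta>\<close> by (auto simp: U_def diameter_cover_seg) (simp add: cover_seg_def)
      ultimately have "hausdorff_premeasure (2/7) \<delta> (measure_support moran_measure)
          \<le> (\<Sum>i. ennreal (diameter (U i) powr (2/7)))"
        unfolding hausdorff_premeasure_def by (intro INF_lower) auto
      also have "\<dots> = (\<Sum>i<ncell k. ennreal (diameter (U i) powr (2/7)))"
        by (intro suminf_finite) (auto simp: U_def)
      also have "\<dots> = (\<Sum>i<ncell k. ennreal (1 / ?n\<^sup>2))"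
      proof (intro sum.cong refl)
        fix i assume i: "i \<in> {..<ncell k}"
        have "(1 / ?n ^ 7) powr (2/7) = ?n powr (- 7 * (2/7))"
          using n1 unfolding powr_powr[symmetric] by (simp add: powr_minus powr_realpow' inverse_eq_divide)
        also have "\<dots> = 1 / ?n\<^sup>2" using n1 by (simp add: powr_minus_divide)
        finally show "ennreal (diameter (U i) powr (2/7)) = ennreal (1 / ?n\<^sup>2)"
          using i by (simp add: U_def diameter_cover_seg)
      qed
      also have "\<dots> = ennreal (1 / ?n)"
        using n1 by (simp add: ennreal_of_nat_eq_real_of_nat power2_eq_square flip: ennreal_mult)
      finally show ?thesis .
    qed
    have "(\<lambda>k. ennreal (1 / real (ncell k))) \<longlonglongrightarrow> ennreal 0"
      by (intro tendsto_ennrealI ncell_inverse_tendsto)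
    moreover have "\<forall>\<^sub>F k in sequentially. 1 / real (ncell k) < \<delta>"
      using ncell_inverse_tendsto \<open>0 < \<delta>\<close> by (rule order_tendstoD(2))
    then have "\<forall>\<^sub>F k in sequentially.
        hausdorff_premeasure (2/7) \<delta> (measure_support moran_measure) \<le> ennreal (1 / real (ncell k))"
      by (rule eventually_mono) (rule le)
    ultimately have "hausdorff_premeasure (2/7) \<delta> (measure_support moran_measure) \<le> ennreal 0"
      by (intro tendsto_lowerbound[of _ "ennreal 0"]) auto
    then show ?thesis by simp
  qed
  then show ?thesis unfolding hausdorff_outer_measure_def by (auto intro!: antisym SUP_least)
qed

lemma hausdorff_dim_moran_support: "hausdorff_dim (measure_support moran_measure) \<le> ennreal (2/7)"
  unfolding hausdorff_dim_def
  by (intro INF_lower) (auto simp: hausdorff_outer_measure_moran_support)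

section \<open>Beurling dimension of the spectrum\<close>

lemma zero_in_freq: "0 \<in> freq k"
  using freq_mono[of 0 k] by auto

text \<open>Counts the frequencies with old part 0, that is \<open>branch k * m\<close>. The radius
  is a perfect square so that its power \<open>1/2\<close> is exactly
  \<open>2 * branch k\<close>.\<close>

lemma moran_spectrum_dense_ball:
  "of_nat (branch k) \<le> emeasure (count_space UNIV) (moran_spectrum \<inter> ball 0 ((2 * real (branch k))\<^sup>2))"
proof -
  let ?A = "(\<lambda>m. real (branch k * m)) ` {..<branch k}"
  have "?A \<subseteq> moran_spectrum \<inter> ball 0 ((2 * real (branch k))\<^sup>2)"
  proof clarify
    fix m assume m: "m < branch k"
    have "branch k * m \<in> freq (Suc k)"
      using m zero_in_freq[of k] by (auto intro!: image_eqI[of _ _ "(0, m)"])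
    then have "real (branch k * m) \<in> moran_spectrum"
      unfolding moran_spectrum_def by blast
    moreover have "real (branch k) * real m < (2 * real (branch k))\<^sup>2"
    proof -
      have "real (branch k) * real m < real (branch k) * real (branch k)" using m by simp
      also have "\<dots> \<le> (2 * real (branch k))\<^sup>2" by (simp add: power2_eq_square)
      finally show ?thesis .
    qed
    ultimately show "real (branch k * m) \<in> moran_spectrum \<inter> ball 0 ((2 * real (branch k))\<^sup>2)"
      by simp
  qed
  then have "emeasure (count_space UNIV) ?A
      \<le> emeasure (count_space UNIV) (moran_spectrum \<inter> ball 0 ((2 * real (branch k))\<^sup>2))"
    by (intro emeasure_mono) auto
  moreover have "card ?A = branch k"
    by (subst card_image) (auto simp: inj_on_def)
  ultimately show ?thesis by (simp add: emeasure_count_space_finite)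
qed

lemma beurling_dim_moran_spectrum: "ennreal (1/2) \<le> beurling_dim moran_spectrum"
proof -
  \<comment> \<open>At radius \<open>4 L\<^sup>2\<close> the ball already contains the \<open>L\<close> frequencies \<open>L m\<close> with \<open>m < L\<close>.\<close>
  let ?f = "\<lambda>h. SUP x::real. emeasure (count_space UNIV) (moran_spectrum \<inter> ball x h) / ennreal (h powr (1/2))"
  have f: "ennreal (1/2) \<le> ?f ((2 * real (branch k))\<^sup>2)" for k
  proof -
    have b: "0 < real (branch k)" by simp
    have "((2 * real (branch k))\<^sup>2) powr (1/2) = 2 * real (branch k)"
      by (subst powr_half_sqrt, simp, subst real_sqrt_abs, simp)
    moreover have "ennreal (1/2) = of_nat (branch k) / ennreal (2 * real (branch k))"
      using b by (simp add: ennreal_of_nat_eq_real_of_nat divide_ennreal del: branch_pos)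
    ultimately have "ennreal (1/2) \<le> emeasure (count_space UNIV)
        (moran_spectrum \<inter> ball 0 ((2 * real (branch k))\<^sup>2)) / ennreal (((2 * real (branch k))\<^sup>2) powr (1/2))"
      using divide_right_mono_ennreal[OF moran_spectrum_dense_ball[of k]] by simp
    then show ?thesis by (rule SUP_upper2[OF UNIV_I])
  qed
  \<comment> \<open>\<open>Limsup\<close> is an infimum over eventually true \<open>P\<close>. The
    radii \<open>(2 * branch k)^2\<close> are unbounded, so each such \<open>P\<close> holds at one
    of them, where the quotient is at least \<open>1/2\<close>.\<close>
  have "ennreal (1/2) \<le> upper_beurling_density (1/2) moran_spectrum"
    unfolding upper_beurling_density_def Limsup_def
  proof (intro INF_greatest, clarify)
    fix P :: "real \<Rightarrow> bool" assume "eventually P at_top"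
    then obtain h0 where h0: "\<And>h. h0 \<le> h \<Longrightarrow> P h" by (auto simp: eventually_at_top_linorder)
    obtain k :: nat where k: "h0 \<le> real k" using real_arch_simple by blast
    have "Suc k \<le> (2 * branch k)\<^sup>2"
    proof -
      have "Suc k \<le> ncell k" by (rule ncell_ge)
      also have "\<dots> \<le> ncell k ^ 2" by (simp add: power2_eq_square Suc_le_eq)
      also have "\<dots> \<le> branch k" by (rule ncell_sq_le_branch)
      also have "\<dots> \<le> (2 * branch k)\<^sup>2" by (simp add: power2_eq_square Suc_le_eq)
      finally show ?thesis .
    qed
    then have "real k \<le> real ((2 * branch k)\<^sup>2)" unfolding of_nat_le_iff by simp
    then have "(2 * real (branch k))\<^sup>2 \<in> {h. P h}" using k h0 by simp
    then show "ennreal (1/2) \<le> (SUP h\<in>{h. P h}. ?f h)"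
      by (rule SUP_upper2) (rule f)
  qed
  moreover have "0 < ennreal (1/2)" unfolding ennreal_0[symmetric] by (subst ennreal_less_iff) auto
  ultimately have "0 < upper_beurling_density (1/2) moran_spectrum" by (rule less_le_trans[rotated])
  then show ?thesis unfolding beurling_dim_def by (intro SUP_upper) auto
qed

section \<open>The frame inequality\<close>

lemma AE_unit_lborel_negligible:
  assumes "negligible N"
  shows "AE x in unit_lborel. x \<notin> N"
proof -
  \<comment> \<open>\<open>negligible\<close> refers to Lebesgue null sets, and \<open>N\<close> may
    fail to be Borel; almost-everywhere statements agree for a measure and its completion.\<close>
  have "AE x in lebesgue. x \<notin> N"
    using assms by (intro AE_not_in) (simp add: negligible_iff_null_sets)
  then have "AE x in lborel. x \<notin> N" by (simp only: AE_completion_iff)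
  then show ?thesis by (subst AE_restrict_space_iff) auto
qed

text \<open>The squared triangle inequality behind all later perturbation estimates; it is the
  source of their factors 2.\<close>

lemma norm_diff_sq_le:
  fixes x y z :: "'a::real_normed_vector"
  shows "(norm (x - z))\<^sup>2 \<le> 2 * (norm (x - y))\<^sup>2 + 2 * (norm (y - z))\<^sup>2"
proof -
  have "(norm (x - z))\<^sup>2 \<le> (norm (x - y) + norm (y - z))\<^sup>2"
    by (intro power_mono norm_ge_zero) (metis norm_triangle_ineq diff_add_cancel add_diff_eq)
  also have "\<dots> \<le> 2 * (norm (x - y))\<^sup>2 + 2 * (norm (y - z))\<^sup>2"
    using sum_squares_bound[of "norm (x - y)" "norm (y - z)"] by (simp add: power2_sum)
  finally show ?thesis .
qed

lemma unit_lborel_tendsto_integral_0: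
  fixes h :: "nat \<Rightarrow> real \<Rightarrow> real"
  assumes "\<And>n. h n \<in> borel_measurable borel" and "integrable unit_lborel w"
    and "negligible N" and "\<And>x. x \<notin> N \<Longrightarrow> x \<in> {0..<1} \<Longrightarrow> (\<lambda>n. h n x) \<longlonglongrightarrow> 0"
    and "\<And>n x. x \<in> {0..<1} \<Longrightarrow> \<bar>h n x\<bar> \<le> w x"
  shows "(\<lambda>n. LINT x|unit_lborel. h n x) \<longlonglongrightarrow> 0"
proof -
  have "(\<lambda>n. LINT x|unit_lborel. h n x) \<longlonglongrightarrow> (LINT x|unit_lborel. 0)"
  proof (rule integral_dominated_convergence[where w = w])
    show "AE x in unit_lborel. (\<lambda>n. h n x) \<longlonglongrightarrow> 0"
      using AE_unit_lborel_negligible[OF assms(3)] AE_space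
      by eventually_elim (use assms(4) in auto)
    show "AE x in unit_lborel. norm (h n x) \<le> w x" for n
      using AE_space by eventually_elim (use assms(5) in auto)
  qed (use assms in \<open>auto intro: measurable_unit_lborel\<close>)
  then show ?thesis by simp
qed

text \<open>A measurable function is almost everywhere a limit of continuous \<open>g n\<close>, but
  without domination. The continuous projection \<open>cl m\<close> onto the disc of radius
  \<open>m\<close> supplies it: \<open>F\<close> is close to \<open>cl m (F x)\<close> for large
  \<open>m\<close>, and \<open>cl m (g n x)\<close> tends to \<open>cl m (F x)\<close>
  boundedly.\<close>

lemma unit_lborel_L2_approx_continuous:
  fixes F :: "real \<Rightarrow> complex"
  assumes F: "F \<in> borel_measurable borel" and int: "integrable unit_lborel (\<lambda>x. (cmod (F x))\<^sup>2)"
    and "0 < e"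
  obtains G where "continuous_on UNIV G" and "integrable unit_lborel (\<lambda>x. (cmod (F x - G x))\<^sup>2)"
    and "(LINT x|unit_lborel. (cmod (F x - G x))\<^sup>2) < e"
proof -
  interpret finite_measure unit_lborel by (rule finite_measure_unit_lborel)
  define cl :: "nat \<Rightarrow> complex \<Rightarrow> complex" where "cl m = closest_point (cball 0 (real m))" for m
  have cont_cl: "continuous_on A (cl m)" for m A
    unfolding cl_def by (intro continuous_on_closest_point) auto
  have [measurable]: "cl m \<in> borel_measurable borel" for m
    by (intro borel_measurable_continuous_onI cont_cl)
  have cl_bound: "cmod (cl m z) \<le> real m" for m z
    using closest_point_in_set[of "cball 0 (real m)" z] by (simp add: cl_def)
  have cl_dist: "cmod (z - cl m z) \<le> cmod z" for m z
    using closest_point_le[of "cball 0 (real m)" 0 z] by (simp add: cl_def dist_norm)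
  have cl_self: "cl m z = z" if "cmod z \<le> real m" for m z
    using that by (simp add: cl_def closest_point_self)
  note [measurable] = F
  have "F \<in> borel_measurable lebesgue"
    using F by (simp add: measurable_completion)
  then have "F measurable_on UNIV" by (rule lebesgue_measurable_imp_measurable_on) simp
  then obtain N g where N: "negligible N" and g: "\<And>n. continuous_on UNIV (g n)"
    and gF: "\<And>x. x \<notin> N \<Longrightarrow> (\<lambda>n. g n x) \<longlonglongrightarrow> F x"
    unfolding measurable_on_def by auto
  have [measurable]: "g n \<in> borel_measurable borel" for n
    by (intro borel_measurable_continuous_onI g)
  have "(\<lambda>m. LINT x|unit_lborel. (cmod (F x - cl m (F x)))\<^sup>2) \<longlonglongrightarrow> 0"
  proof (rule unit_lborel_tendsto_integral_0[OF _ int, of _ "{}"])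
    fix x
    obtain m0 :: nat where "cmod (F x) \<le> real m0" using real_arch_simple by blast
    then have "\<forall>m\<ge>m0. (cmod (F x - cl m (F x)))\<^sup>2 = 0" using cl_self by force
    then show "(\<lambda>m. (cmod (F x - cl m (F x)))\<^sup>2) \<longlonglongrightarrow> 0"
      by (intro tendsto_eventually) (auto simp: eventually_sequentially)
  qed (auto intro: power_mono cl_dist)
  \<comment> \<open>Both errors are kept below \<open>e / 4\<close>, since
    \<open>norm_diff_sq_le\<close> doubles each of them.\<close>
  then have "\<forall>\<^sub>F m in sequentially. (LINT x|unit_lborel. (cmod (F x - cl m (F x)))\<^sup>2) < e / 4"
    using \<open>0 < e\<close> by (intro order_tendstoD(2)) auto
  from eventually_happens'[OF sequentially_bot this]
  obtain m where m: "(LINT x|unit_lborel. (cmod (F x - cl m (F x)))\<^sup>2) < e / 4" by blast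
  have bnd: "(cmod (cl m (F x) - cl m (g n x)))\<^sup>2 \<le> (2 * real m)\<^sup>2" for n x
    using norm_triangle_ineq4[of "cl m (F x)" "cl m (g n x)"] cl_bound[of m "F x"] cl_bound[of m "g n x"]
    by (intro power_mono) auto
  have "(\<lambda>n. LINT x|unit_lborel. (cmod (cl m (F x) - cl m (g n x)))\<^sup>2) \<longlonglongrightarrow> 0"
  proof (rule unit_lborel_tendsto_integral_0[where w = "\<lambda>_. (2 * real m)\<^sup>2", OF _ _ N])
    fix x assume "x \<notin> N"
    then have "(\<lambda>n. cl m (g n x)) \<longlonglongrightarrow> cl m (F x)"
      using continuous_on_tendsto_compose[OF cont_cl[of UNIV m] gF] by simp
    from tendsto_diff[OF tendsto_const[of "cl m (F x)"] this]
    have "(\<lambda>n. cmod (cl m (F x) - cl m (g n x))) \<longlonglongrightarrow> 0"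
      by (simp add: tendsto_norm_zero)
    from tendsto_power[OF this, of 2]
    show "(\<lambda>n. (cmod (cl m (F x) - cl m (g n x)))\<^sup>2) \<longlonglongrightarrow> 0" by simp
  qed (use bnd in auto)
  then have "\<forall>\<^sub>F n in sequentially. (LINT x|unit_lborel. (cmod (cl m (F x) - cl m (g n x)))\<^sup>2) < e / 4"
    using \<open>0 < e\<close> by (intro order_tendstoD(2)) auto
  from eventually_happens'[OF sequentially_bot this]
  obtain n where n: "(LINT x|unit_lborel. (cmod (cl m (F x) - cl m (g n x)))\<^sup>2) < e / 4" by blast
  define G where "G x = cl m (g n x)" for x
  have i1: "integrable unit_lborel (\<lambda>x. (cmod (F x - cl m (F x)))\<^sup>2)"
    by (rule Bochner_Integration.integrable_bound[OF int])
      (auto intro!: measurable_unit_lborel power_mono cl_dist)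
  have i2: "integrable unit_lborel (\<lambda>x. (cmod (cl m (F x) - G x))\<^sup>2)"
    by (rule Bochner_Integration.integrable_bound[of _ "\<lambda>_. (2 * real m)\<^sup>2"])
      (use bnd in \<open>auto simp: G_def[abs_def] intro!: measurable_unit_lborel\<close>)
  have le: "(cmod (F x - G x))\<^sup>2 \<le> 2 * (cmod (F x - cl m (F x)))\<^sup>2 + 2 * (cmod (cl m (F x) - G x))\<^sup>2" for x
    by (rule norm_diff_sq_le)
  have i3: "integrable unit_lborel (\<lambda>x. 2 * (cmod (F x - cl m (F x)))\<^sup>2 + 2 * (cmod (cl m (F x) - G x))\<^sup>2)"
    using i1 i2 by simp
  have i4: "integrable unit_lborel (\<lambda>x. (cmod (F x - G x))\<^sup>2)"
    by (rule Bochner_Integration.integrable_bound[OF i3])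
      (use le in \<open>auto simp: G_def[abs_def] intro!: measurable_unit_lborel\<close>)
  have "(LINT x|unit_lborel. (cmod (F x - G x))\<^sup>2)
      \<le> (LINT x|unit_lborel. 2 * (cmod (F x - cl m (F x)))\<^sup>2 + 2 * (cmod (cl m (F x) - G x))\<^sup>2)"
    by (intro integral_mono i3 i4 le)
  also have "\<dots> < e" using m n i1 i2 by (simp add: G_def)
  finally have "(LINT x|unit_lborel. (cmod (F x - G x))\<^sup>2) < e" .
  moreover have "continuous_on UNIV G"
    unfolding G_def using continuous_on_compose2[OF cont_cl[of UNIV m] g[of n]] by simp
  ultimately show thesis using i4 that by blast
qed

text \<open>Completing the square in \<open>z\<close> around the mean of \<open>F\<close> over
  \<open>I\<close>. Taking \<open>z\<close> to be the mean gives the Cauchy-Schwarz inequality; for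
  any other \<open>z\<close> the last term shows that the mean is the best constant.\<close>

lemma set_integral_cmod_sq_diff:
  fixes F :: "'a \<Rightarrow> complex" and z :: complex
  assumes "I \<in> sets M" "emeasure M I \<noteq> \<infinity>" "0 < measure M I"
    and F: "set_integrable M I F" and F2: "set_integrable M I (\<lambda>x. (cmod (F x))\<^sup>2)"
  shows "(LINT x:I|M. (cmod (F x - z))\<^sup>2)
       = (LINT x:I|M. (cmod (F x))\<^sup>2) - (cmod (LINT x:I|M. F x))\<^sup>2 / measure M I
         + (cmod ((LINT x:I|M. F x) - measure M I * z))\<^sup>2 / measure M I"
proof -
  let ?a = "LINT x:I|M. F x" and ?m = "measure M I"
  have Re_int: "set_integrable M I (\<lambda>x. Re (cnj z * F x))"
    "(LINT x:I|M. Re (cnj z * F x)) = Re (cnj z * ?a)"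
  proof -
    have i: "set_integrable M I (\<lambda>x. cnj z * F x)" using F by simp
    have e: "(\<lambda>x. indicator I x *\<^sub>R Re (cnj z * F x)) = (\<lambda>x. Re (indicator I x *\<^sub>R (cnj z * F x)))"
      by auto
    show "set_integrable M I (\<lambda>x. Re (cnj z * F x))"
      using i unfolding set_integrable_def e by (rule integrable_Re)
    have "(LINT x:I|M. Re (cnj z * F x)) = Re (LINT x:I|M. cnj z * F x)"
      using i unfolding set_integrable_def set_lebesgue_integral_def e by (rule integral_Re)
    then show "(LINT x:I|M. Re (cnj z * F x)) = Re (cnj z * ?a)"
      by simp
  qed
  have sq: "(cmod (u - v))\<^sup>2 = (cmod u)\<^sup>2 - 2 * Re (cnj v * u) + (cmod v)\<^sup>2" for u v
    unfolding cmod_power2 by (simp add: power2_eq_square algebra_simps)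
  have cst: "set_integrable M I (\<lambda>_. (cmod z)\<^sup>2)"
    unfolding set_integrable_def using assms(1,2) by (simp add: less_top)
  have "(LINT x:I|M. (cmod (F x - z))\<^sup>2)
      = (LINT x:I|M. (cmod (F x))\<^sup>2) - 2 * Re (cnj z * ?a) + ?m * (cmod z)\<^sup>2"
    unfolding sq using F2 Re_int cst assms(1,2)
    by (simp add: set_integral_const del: times_complex.sel cnj.sel)
  also have "\<dots> = (LINT x:I|M. (cmod (F x))\<^sup>2) - (cmod ?a)\<^sup>2 / ?m + (cmod (?a - ?m * z))\<^sup>2 / ?m"
    using assms(3) unfolding sq[of ?a]
    by (simp add: field_simps norm_mult power_mult_distrib) (simp add: power2_eq_square algebra_simps)
  finally show ?thesis .
qed

section \<open>Partition of the unit interval into cells\<close>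

definition cell :: "nat \<Rightarrow> nat \<Rightarrow> real set" where
  "cell k j = {real j / real (ncell k) ..< real (Suc j) / real (ncell k)}"

text \<open>Nonnegativity of \<open>t\<close> matters: \<open>nat\<close> would send negative floors
  to index 0.\<close>

lemma in_cell_iff: "0 \<le> t \<Longrightarrow> t \<in> cell k j \<longleftrightarrow> nat \<lfloor>t * real (ncell k)\<rfloor> = j"
proof -
  assume t: "0 \<le> t"
  have "t \<in> cell k j \<longleftrightarrow> real j \<le> t * real (ncell k) \<and> t * real (ncell k) < real j + 1"
    by (simp add: cell_def field_simps)
  also have "\<dots> \<longleftrightarrow> \<lfloor>t * real (ncell k)\<rfloor> = int j"
    by (simp add: floor_eq_iff)
  also have "\<dots> \<longleftrightarrow> nat \<lfloor>t * real (ncell k)\<rfloor> = j"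
    using t by (auto simp: nat_eq_iff)
  finally show ?thesis .
qed

lemma cell_subset: "j < ncell k \<Longrightarrow> cell k j \<subseteq> {0..<1}"
proof
  fix t assume j: "j < ncell k" and t: "t \<in> cell k j"
  then have "real (Suc j) / real (ncell k) \<le> 1" by simp
  moreover have "0 \<le> real j / real (ncell k)" by simp
  moreover have "real j / real (ncell k) \<le> t" "t < real (Suc j) / real (ncell k)"
    using t by (simp_all add: cell_def)
  ultimately have "0 \<le> t" "t < 1" using order_trans less_le_trans by blast+
  then show "t \<in> {0..<1}" by simp
qed

lemma UN_cell: "(\<Union>j<ncell k. cell k j) = {0..<1}"
proof
  show "(\<Union>j<ncell k. cell k j) \<subseteq> {0..<1}" by (intro UN_least cell_subset) simp
  show "{0..<1} \<subseteq> (\<Union>j<ncell k. cell k j)"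
  proof
    fix t :: real assume t: "t \<in> {0..<1}"
    then have "t \<in> cell k (nat \<lfloor>t * real (ncell k)\<rfloor>)" by (simp only: in_cell_iff atLeastLessThan_iff)
    then show "t \<in> (\<Union>j<ncell k. cell k j)" using cell_index_less[OF t] by blast
  qed
qed

lemma disjoint_cell: "disjoint_family_on (cell k) {..<ncell k}"
  unfolding disjoint_family_on_def
proof (intro ballI impI)
  fix i j assume ij: "i \<in> {..<ncell k}" "j \<in> {..<ncell k}" "i \<noteq> j"
  have "x \<notin> cell k j" if x: "x \<in> cell k i" for x
  proof -
    have "x \<in> {0..<1}" using cell_subset[of i k] ij(1) x by blast
    then have "0 \<le> x" by simp
    then show ?thesis using in_cell_iff[of x k i] in_cell_iff[of x k j] x ij(3) by simp
  qed
  then show "cell k i \<inter> cell k j = {}" by blast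
qed

lemma sets_cell: "j < ncell k \<Longrightarrow> cell k j \<in> sets unit_lborel"
  using cell_subset[of j k] by (simp add: sets_restrict_space_iff) (simp add: cell_def)

lemma emeasure_cell: "j < ncell k \<Longrightarrow> emeasure unit_lborel (cell k j) = ennreal (1 / real (ncell k))"
  using cell_subset[of j k]
  by (simp add: emeasure_restrict_space cell_def field_simps divide_right_mono)

lemma measure_cell: "j < ncell k \<Longrightarrow> measure unit_lborel (cell k j) = 1 / real (ncell k)"
  by (simp add: measure_def emeasure_cell)

lemma integral_cells:
  fixes h :: "real \<Rightarrow> 'a::{banach, second_countable_topology}"
  assumes "integrable unit_lborel h"
  shows "(LINT x|unit_lborel. h x) = (\<Sum>j<ncell k. LINT x:cell k j|unit_lborel. h x)"
proof -
  have "(LINT x|unit_lborel. h x) = (LINT x:(\<Union>j<ncell k. cell k j)|unit_lborel. h x)"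
    using set_integral_space[OF assms] by (simp add: UN_cell)
  also have "\<dots> = (\<Sum>j<ncell k. LINT x:cell k j|unit_lborel. h x)"
    using assms
    by (intro set_integral_finite_Union disjoint_cell)
       (auto simp: sets_cell set_integrable_def intro!: integrable_mult_indicator)
  finally show ?thesis .
qed

section \<open>Square integrable functions and their energies\<close>

context
  fixes F :: "real \<Rightarrow> complex"
  assumes F [measurable]: "F \<in> borel_measurable borel"
    and F2: "integrable unit_lborel (\<lambda>x. (cmod (F x))\<^sup>2)"
begin

lemma L2_integrable: "integrable unit_lborel F"
proof -
  interpret finite_measure unit_lborel by (rule finite_measure_unit_lborel)
  have "integrable unit_lborel (\<lambda>x. F x ^ 2)"
    by (rule Bochner_Integration.integrable_bound[OF F2])
      (auto intro!: measurable_unit_lborel simp: norm_power)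
  with measurable_unit_lborel[OF F] show ?thesis by (rule square_integrable_imp_integrable)
qed

lemma L2_set_integrable:
  assumes "I \<in> sets unit_lborel"
  shows "set_integrable unit_lborel I F" "set_integrable unit_lborel I (\<lambda>x. (cmod (F x))\<^sup>2)"
  unfolding set_integrable_def
  using integrable_mult_indicator[OF assms L2_integrable] integrable_mult_indicator[OF assms F2]
  by blast+

text \<open>The variance of \<open>cmod (F x)\<close> under a probability measure is
  nonnegative.\<close>

lemma L1_sq_le_L2_sq: "(LINT x|unit_lborel. cmod (F x))\<^sup>2 \<le> (LINT x|unit_lborel. (cmod (F x))\<^sup>2)"
proof -
  let ?m = "LINT x|unit_lborel. cmod (F x)"
  interpret finite_measure unit_lborel by (rule finite_measure_unit_lborel)
  have m1: "measure unit_lborel {0..<1} = 1" by (simp add: measure_def)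
  have "0 \<le> (LINT x|unit_lborel. (cmod (F x) - ?m)\<^sup>2)" by simp
  also have "\<dots> = (LINT x|unit_lborel. (cmod (F x))\<^sup>2 - 2 * ?m * cmod (F x) + ?m\<^sup>2)"
    by (intro Bochner_Integration.integral_cong refl) (simp add: power2_eq_square algebra_simps)
  also have "\<dots> = (LINT x|unit_lborel. (cmod (F x))\<^sup>2) - ?m\<^sup>2"
    using F2 L2_integrable by (simp add: power2_eq_square m1)
  finally show ?thesis by simp
qed

definition cell_integral :: "nat \<Rightarrow> nat \<Rightarrow> complex" where
  "cell_integral k j = (LINT x:cell k j|unit_lborel. F x)"

text \<open>The squared \<open>L\<^sup>2\<close> norm of the conditional expectation of \<open>F\<close> on the cells of level \<open>k\<close>.\<close>

definition energy :: "nat \<Rightarrow> real" where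
  "energy k = real (ncell k) * (\<Sum>j<ncell k. (cmod (cell_integral k j))\<^sup>2)"

lemma cell_sq_diff:
  fixes z :: complex
  assumes "j < ncell k"
  shows "(LINT x:cell k j|unit_lborel. (cmod (F x - z))\<^sup>2)
       = (LINT x:cell k j|unit_lborel. (cmod (F x))\<^sup>2) - real (ncell k) * (cmod (cell_integral k j))\<^sup>2
         + real (ncell k) * (cmod (cell_integral k j - z / of_nat (ncell k)))\<^sup>2"
proof -
  have "emeasure unit_lborel (cell k j) \<noteq> \<infinity>" "0 < measure unit_lborel (cell k j)"
    by (simp_all add: emeasure_cell[OF assms] measure_cell[OF assms])
  from set_integral_cmod_sq_diff[OF sets_cell[OF assms] this L2_set_integrable[OF sets_cell[OF assms]], where z = z]
  show ?thesis unfolding measure_cell[OF assms] cell_integral_def by simp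
qed

text \<open>On each cell, \<open>z\<close> is chosen as the mean
  \<open>ncell k * cell_integral k j\<close>, which makes the last square of
  \<open>cell_sq_diff\<close> vanish, while the left side is nonnegative.\<close>

lemma energy_le: "energy k \<le> (LINT x|unit_lborel. (cmod (F x))\<^sup>2)"
proof -
  have "real (ncell k) * (cmod (cell_integral k j))\<^sup>2 \<le> (LINT x:cell k j|unit_lborel. (cmod (F x))\<^sup>2)"
    if "j < ncell k" for j
  proof -
    have "0 \<le> (LINT x:cell k j|unit_lborel. (cmod (F x - real (ncell k) * cell_integral k j))\<^sup>2)"
      unfolding set_lebesgue_integral_def by simp
    then show ?thesis
      using cell_sq_diff[OF that, of "real (ncell k) * cell_integral k j"] by simp
  qed
  then show ?thesis unfolding energy_def integral_cells[OF F2, of k] sum_distrib_left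
    by (intro sum_mono) auto
qed

text \<open>Dropping that last square instead: no step function on the cells approximates
  \<open>F\<close> better than the conditional expectation.\<close>

lemma energy_ge_step:
  "(LINT x|unit_lborel. (cmod (F x))\<^sup>2)
    - (\<Sum>j<ncell k. LINT x:cell k j|unit_lborel. (cmod (F x - z j))\<^sup>2) \<le> energy k"
proof -
  have "(LINT x:cell k j|unit_lborel. (cmod (F x))\<^sup>2) - (LINT x:cell k j|unit_lborel. (cmod (F x - z j))\<^sup>2)
      \<le> real (ncell k) * (cmod (cell_integral k j))\<^sup>2" if "j < ncell k" for j
    using cell_sq_diff[OF that, of "z j"] by simp
  then show ?thesis unfolding energy_def integral_cells[OF F2, of k] sum_distrib_left sum_subtractf[symmetric]
    by (intro sum_mono) auto
qed

text \<open>A continuous \<open>G\<close> near \<open>F\<close> is almost constant on small cells,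
  so its values at the left endpoints give a good step function for \<open>energy_ge_step\<close>.
  The condition \<open>k \<ge> 1\<close> is for \<open>sum_freq_error\<close>.\<close>

lemma ex_energy_ge:
  "\<exists>k\<ge>1. 3/4 * (LINT x|unit_lborel. (cmod (F x))\<^sup>2) \<le> energy k"
proof (cases "(LINT x|unit_lborel. (cmod (F x))\<^sup>2) = 0")
  case True
  have "0 \<le> energy 1" by (simp add: energy_def sum_nonneg)
  then show ?thesis using True by (intro exI[of _ 1]) simp
next
  case False
  define E where "E = (LINT x|unit_lborel. (cmod (F x))\<^sup>2)"
  have "0 \<le> E" unfolding E_def by simp
  with False have E: "0 < E" unfolding E_def by linarith
  obtain G where G: "continuous_on UNIV G" "integrable unit_lborel (\<lambda>x. (cmod (F x - G x))\<^sup>2)"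
    \<comment> \<open>The squared distance to \<open>G\<close> and the squared oscillation of
      \<open>G\<close> are each at most \<open>E / 16\<close>; doubled and added they give
      \<open>E / 4\<close>, the loss from 1 to \<open>3/4\<close>.\<close>
    "(LINT x|unit_lborel. (cmod (F x - G x))\<^sup>2) < E / 16"
    using unit_lborel_L2_approx_continuous[OF F F2, of "E / 16"] E by auto
  have "uniformly_continuous_on {0..1::real} G"
    using G(1) continuous_on_subset by (intro compact_uniformly_continuous) auto
  moreover have "0 < sqrt (E / 16)" using E by simp
  ultimately obtain d where d: "0 < d"
    "\<And>x y. x \<in> {0..1} \<Longrightarrow> y \<in> {0..1} \<Longrightarrow> dist y x < d \<Longrightarrow> dist (G y) (G x) < sqrt (E / 16)"
    unfolding uniformly_continuous_on_def by blast
  have "\<forall>\<^sub>F k in sequentially. 1 / real (ncell k) < d"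
    using ncell_inverse_tendsto d(1) by (rule order_tendstoD(2))
  then have "\<forall>\<^sub>F k in sequentially. 1 \<le> k \<and> 1 / real (ncell k) < d"
    using eventually_ge_at_top[of 1] by eventually_elim auto
  from eventually_happens'[OF sequentially_bot this]
  obtain k where k: "1 \<le> k" "1 / real (ncell k) < d" by blast
  define z where "z j = G (real j / real (ncell k))" for j
  have cell_le: "(LINT x:cell k j|unit_lborel. (cmod (F x - z j))\<^sup>2)
      \<le> 2 * (LINT x:cell k j|unit_lborel. (cmod (F x - G x))\<^sup>2) + 2 * (E / 16) / real (ncell k)"
    if j: "j < ncell k" for j
  proof -
    have osc: "(cmod (G x - z j))\<^sup>2 \<le> E / 16" if x: "x \<in> cell k j" for x
    proof -
      have "real j / real (ncell k) \<in> {0..1}" using j by auto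
      moreover have "x \<in> {0..1}" using cell_subset[OF j] x by fastforce
      moreover have "dist x (real j / real (ncell k)) < d"
        using x k(2) by (auto simp: cell_def dist_real_def add_divide_distrib)
      ultimately have "cmod (G x - z j) < sqrt (E / 16)"
        unfolding z_def dist_norm[symmetric] by (rule d(2))
      then have "(cmod (G x - z j))\<^sup>2 \<le> (sqrt (E / 16))\<^sup>2"
        by (intro power_mono) auto
      then show ?thesis using E by simp
    qed
    have le: "(cmod (F x - z j))\<^sup>2 \<le> 2 * (cmod (F x - G x))\<^sup>2 + 2 * (E / 16)" if "x \<in> cell k j" for x
      using norm_diff_sq_le[of "F x" "z j" "G x"] osc[OF that] by linarith
    have i1: "set_integrable unit_lborel (cell k j) (\<lambda>x. (cmod (F x - G x))\<^sup>2)"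
      unfolding set_integrable_def using G(2) sets_cell[OF j] by (intro integrable_mult_indicator)
    have i2: "set_integrable unit_lborel (cell k j) (\<lambda>x. 2 * (E / 16))"
      unfolding set_integrable_def using sets_cell[OF j] by (simp add: emeasure_cell[OF j])
    have i3: "set_integrable unit_lborel (cell k j) (\<lambda>x. 2 * (cmod (F x - G x))\<^sup>2 + 2 * (E / 16))"
      using i1 i2 by (intro set_integral_add(1)) auto
    have "set_integrable unit_lborel (cell k j) (\<lambda>x. (cmod (F x - z j))\<^sup>2)"
    proof (rule set_integrable_bound[OF i3])
      show "set_borel_measurable unit_lborel (cell k j) (\<lambda>x. (cmod (F x - z j))\<^sup>2)"
        unfolding set_borel_measurable_def cell_def by (intro measurable_unit_lborel) measurable
      show "AE x\<in>cell k j in unit_lborel.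
          norm ((cmod (F x - z j))\<^sup>2) \<le> norm (2 * (cmod (F x - G x))\<^sup>2 + 2 * (E / 16))"
        using le by (intro AE_I2 impI) (simp add: order_trans[OF _ abs_ge_self])
    qed
    then have "(LINT x:cell k j|unit_lborel. (cmod (F x - z j))\<^sup>2)
        \<le> (LINT x:cell k j|unit_lborel. 2 * (cmod (F x - G x))\<^sup>2 + 2 * (E / 16))"
      by (intro set_integral_mono i3 le)
    also have "\<dots> = 2 * (LINT x:cell k j|unit_lborel. (cmod (F x - G x))\<^sup>2) + 2 * (E / 16) / real (ncell k)"
      using i1 i2 sets_cell[OF j]
      by (subst set_integral_add(2)) (auto simp: set_integral_const emeasure_cell[OF j] measure_cell[OF j])
    finally show ?thesis .
  qed
  have "(\<Sum>j<ncell k. LINT x:cell k j|unit_lborel. (cmod (F x - z j))\<^sup>2)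
      \<le> (\<Sum>j<ncell k. 2 * (LINT x:cell k j|unit_lborel. (cmod (F x - G x))\<^sup>2) + 2 * (E / 16) / real (ncell k))"
    by (intro sum_mono cell_le) simp
  also have "\<dots> = 2 * (LINT x|unit_lborel. (cmod (F x - G x))\<^sup>2) + 2 * (E / 16)"
    unfolding integral_cells[OF G(2), of k] by (simp add: sum.distrib sum_distrib_left)
  also have "\<dots> \<le> E / 4" using G(3) by simp
  finally have "(\<Sum>j<ncell k. LINT x:cell k j|unit_lborel. (cmod (F x - z j))\<^sup>2) \<le> E / 4" .
  then have "3/4 * E \<le> energy k" using energy_ge_step[of k z] unfolding E_def by linarith
  then show ?thesis using k(1) unfolding E_def by blast
qed

section \<open>Frame sums over a single level\<close>

lemma sum_freq_approx_pt:
  "(\<Sum>l\<in>freq k. (cmod (LINT x|unit_lborel. F x * chi (real l * approx_pt k x)))\<^sup>2) = energy k"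
proof -
  have "(LINT x|unit_lborel. F x * chi (real l * approx_pt k x))
      = (\<Sum>j<ncell k. cell_integral k j * chi (real l * pt k j))" for l
  proof -
    have "integrable unit_lborel (\<lambda>x. F x * chi (real l * approx_pt k x))"
      by (rule Bochner_Integration.integrable_bound[OF L2_integrable])
        (auto intro!: measurable_unit_lborel simp: norm_mult)
    then have "(LINT x|unit_lborel. F x * chi (real l * approx_pt k x))
        = (\<Sum>j<ncell k. LINT x:cell k j|unit_lborel. F x * chi (real l * approx_pt k x))"
      by (rule integral_cells)
    also have "\<dots> = (\<Sum>j<ncell k. LINT x:cell k j|unit_lborel. F x * chi (real l * pt k j))"
    proof (intro sum.cong refl)
      fix j assume "j \<in> {..<ncell k}"
      then have j: "j < ncell k" by simp
      \<comment> \<open>\<open>approx_pt k\<close> is constant on each cell, so the integral is a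
        finite exponential sum with coefficients \<open>cell_integral k j\<close>, to which
        \<open>pt_parseval\<close> applies.\<close>
      have "approx_pt k x = pt k j" if "x \<in> cell k j" for x
        using that cell_subset[OF j] in_cell_iff[of x k j] by (auto simp: approx_pt_def)
      then show "(LINT x:cell k j|unit_lborel. F x * chi (real l * approx_pt k x))
          = (LINT x:cell k j|unit_lborel. F x * chi (real l * pt k j))"
        using sets_cell[OF j] by (intro set_lebesgue_integral_cong) auto
    qed
    also have "\<dots> = (\<Sum>j<ncell k. cell_integral k j * chi (real l * pt k j))"
      by (simp add: cell_integral_def)
    finally show ?thesis .
  qed
  then show ?thesis by (simp add: pt_parseval energy_def)
qed

text \<open>With \<open>n = ncell k\<close>, the frequency is below \<open>n^2\<close> and the point
  moves by at most \<open>2 / branch k = 1 / n ^ 7\<close>, so the phases differ by at most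
  \<open>2 * pi / n ^ 5\<close>.\<close>

lemma fourier_moran_approx:
  assumes "l \<in> freq k"
  shows "cmod ((LINT x|unit_lborel. F x * chi (real l * moran x))
              - (LINT x|unit_lborel. F x * chi (real l * approx_pt k x)))
       \<le> 2 * pi / real (ncell k) ^ 5 * (LINT x|unit_lborel. cmod (F x))"
proof -
  have i: "integrable unit_lborel (\<lambda>x. F x * chi (real l * moran x))"
    "integrable unit_lborel (\<lambda>x. F x * chi (real l * approx_pt k x))"
    by (rule Bochner_Integration.integrable_bound[OF L2_integrable];
        auto intro!: measurable_unit_lborel simp: norm_mult)+
  have "cmod ((LINT x|unit_lborel. F x * chi (real l * moran x))
              - (LINT x|unit_lborel. F x * chi (real l * approx_pt k x)))
      = cmod (LINT x|unit_lborel. F x * chi (real l * moran x) - F x * chi (real l * approx_pt k x))"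
    using i by simp
  also have "\<dots> \<le> (LINT x|unit_lborel. 2 * pi / real (ncell k) ^ 5 * cmod (F x))"
  proof (rule Bochner_Integration.integral_norm_bound_integral)
    fix x assume "x \<in> space unit_lborel"
    then have x: "0 \<le> x" by simp
    have "cmod (chi (real l * moran x) - chi (real l * approx_pt k x))
        \<le> 2 * pi * \<bar>real l * moran x - real l * approx_pt k x\<bar>"
      by (rule norm_chi_diff)
    also have "\<dots> = 2 * pi * (real l * (moran x - approx_pt k x))"
      using moran_bounds(1)[OF x, of k] by (simp add: right_diff_distrib[symmetric] abs_mult)
    also have "\<dots> \<le> 2 * pi * (real ((ncell k)\<^sup>2) * (2 / real (branch k)))"
      using moran_bounds[OF x, of k] freq_less[OF assms]
      by (intro mult_left_mono mult_mono) (auto simp del: of_nat_power)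
    also have "\<dots> = 2 * pi / real (ncell k) ^ 5"
      by (simp add: branch_def power2_eq_square eval_nat_numeral)
    finally have "cmod (chi (real l * moran x) - chi (real l * approx_pt k x)) \<le> 2 * pi / real (ncell k) ^ 5" .
    then show "norm (F x * chi (real l * moran x) - F x * chi (real l * approx_pt k x))
        \<le> 2 * pi / real (ncell k) ^ 5 * cmod (F x)"
      unfolding right_diff_distrib[symmetric] norm_mult
      by (subst mult.commute) (rule mult_right_mono, simp_all)
  qed (use i L2_integrable in auto)
  finally show ?thesis by simp
qed

text \<open>The \<open>n\<close> frequencies of the level contribute a squared error of order
  \<open>1 / n ^ 10\<close> each, in total \<open>1 / n ^ 9\<close>.\<close>

lemma sum_freq_error:
  assumes "1 \<le> k"
  shows "(\<Sum>l\<in>freq k. (cmod ((LINT x|unit_lborel. F x * chi (real l * moran x))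
              - (LINT x|unit_lborel. F x * chi (real l * approx_pt k x))))\<^sup>2)
       \<le> (LINT x|unit_lborel. (cmod (F x))\<^sup>2) / 8"
proof -
  let ?n = "real (ncell k)" and ?E = "LINT x|unit_lborel. (cmod (F x))\<^sup>2"
  have n2: "2 \<le> ?n" using ncell_ge[of k] assms by linarith
  have "(\<Sum>l\<in>freq k. (cmod ((LINT x|unit_lborel. F x * chi (real l * moran x))
              - (LINT x|unit_lborel. F x * chi (real l * approx_pt k x))))\<^sup>2)
      \<le> (\<Sum>l\<in>freq k. (2 * pi / ?n ^ 5 * (LINT x|unit_lborel. cmod (F x)))\<^sup>2)"
    by (intro sum_mono power_mono fourier_moran_approx) auto
  also have "\<dots> = (2 * pi)\<^sup>2 / ?n ^ 9 * (LINT x|unit_lborel. cmod (F x))\<^sup>2"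
    using n2 by (simp add: card_freq power_mult_distrib power_divide flip: power_mult)
      (simp add: field_simps eval_nat_numeral)
  \<comment> \<open>Here \<open>2 * pi < 8\<close> and \<open>n \<ge> 2\<close>; the latter fails at
    level 0, hence \<open>1 \<le> k\<close>.\<close>
  also have "\<dots> \<le> 8\<^sup>2 / 2 ^ 9 * ?E"
    using n2 pi_less_4 by (intro mult_mono frac_le power_mono L1_sq_le_L2_sq) auto
  also have "\<dots> = ?E / 8" by simp
  finally show ?thesis .
qed

lemma sum_freq_moran_le:
  assumes "1 \<le> k"
  shows "(\<Sum>l\<in>freq k. (cmod (LINT x|unit_lborel. F x * chi (real l * moran x)))\<^sup>2)
       \<le> 4 * (LINT x|unit_lborel. (cmod (F x))\<^sup>2)"
proof -
  let ?b = "\<lambda>l. LINT x|unit_lborel. F x * chi (real l * moran x)"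
  let ?c = "\<lambda>l. LINT x|unit_lborel. F x * chi (real l * approx_pt k x)"
  have "(cmod (?b l))\<^sup>2 \<le> 2 * (cmod (?b l - ?c l))\<^sup>2 + 2 * (cmod (?c l))\<^sup>2" for l
    using norm_diff_sq_le[of "?b l" 0 "?c l"] by simp
  then have "(\<Sum>l\<in>freq k. (cmod (?b l))\<^sup>2) \<le> (\<Sum>l\<in>freq k. 2 * (cmod (?b l - ?c l))\<^sup>2 + 2 * (cmod (?c l))\<^sup>2)"
    by (intro sum_mono)
  also have "\<dots> = 2 * (\<Sum>l\<in>freq k. (cmod (?b l - ?c l))\<^sup>2) + 2 * energy k"
    by (simp add: sum.distrib sum_distrib_left flip: sum_freq_approx_pt)
  finally have "(\<Sum>l\<in>freq k. (cmod (?b l))\<^sup>2)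
      \<le> 2 * (\<Sum>l\<in>freq k. (cmod (?b l - ?c l))\<^sup>2) + 2 * energy k" .
  moreover have "0 \<le> (LINT x|unit_lborel. (cmod (F x))\<^sup>2)" by simp
  \<comment> \<open>The constant obtained is \<open>2/8 + 2\<close>, which is below 4.\<close>
  ultimately have "(\<Sum>l\<in>freq k. (cmod (?b l))\<^sup>2) \<le> 4 * (LINT x|unit_lborel. (cmod (F x))\<^sup>2)"
    using sum_freq_error[OF assms] energy_le[of k]
    by linarith
  then show ?thesis .
qed

lemma sum_freq_moran_ge:
  "\<exists>k. 1/4 * (LINT x|unit_lborel. (cmod (F x))\<^sup>2)
      \<le> (\<Sum>l\<in>freq k. (cmod (LINT x|unit_lborel. F x * chi (real l * moran x)))\<^sup>2)"
proof -
  obtain k where k: "1 \<le> k" "3/4 * (LINT x|unit_lborel. (cmod (F x))\<^sup>2) \<le> energy k"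
    using ex_energy_ge by blast
  let ?b = "\<lambda>l. LINT x|unit_lborel. F x * chi (real l * moran x)"
  let ?c = "\<lambda>l. LINT x|unit_lborel. F x * chi (real l * approx_pt k x)"
  have "energy k = (\<Sum>l\<in>freq k. (cmod (?c l))\<^sup>2)" by (rule sum_freq_approx_pt[symmetric])
  also have "\<dots> \<le> (\<Sum>l\<in>freq k. 2 * (cmod (?b l - ?c l))\<^sup>2 + 2 * (cmod (?b l))\<^sup>2)"
  proof (rule sum_mono)
    fix l
    show "(cmod (?c l))\<^sup>2 \<le> 2 * (cmod (?b l - ?c l))\<^sup>2 + 2 * (cmod (?b l))\<^sup>2"
      using norm_diff_sq_le[of "?c l" 0 "?b l"] by (simp add: norm_minus_commute)
  qed
  also have "\<dots> = 2 * (\<Sum>l\<in>freq k. (cmod (?b l - ?c l))\<^sup>2) + 2 * (\<Sum>l\<in>freq k. (cmod (?b l))\<^sup>2)"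
    by (simp add: sum.distrib sum_distrib_left)
  \<comment> \<open>From \<open>3/4 \<le> 2/8 + 2 * s\<close>, with \<open>s\<close> the frame sum
    relative to the squared norm, it follows that \<open>s \<ge> 1/4\<close>.\<close>
  finally show ?thesis using sum_freq_error[OF k(1)] k(2) by (intro exI[of _ k]) linarith
qed

end

section \<open>Transfer to the measure and its spectrum\<close>

lemma finite_subset_moran_spectrum:
  assumes "finite A" "A \<subseteq> moran_spectrum"
  shows "\<exists>k\<ge>1. A \<subseteq> real ` freq k"
  using assms
proof (induction A rule: finite_induct)
  case (insert a A)
  then obtain k where k: "1 \<le> k" "A \<subseteq> real ` freq k" by auto
  obtain k' where "a \<in> real ` freq k'" using insert.prems by (auto simp: moran_spectrum_def)
  then have "insert a A \<subseteq> real ` freq (max k k')"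
    using k(2) freq_mono[of k "max k k'"] freq_mono[of k' "max k k'"] by auto
  then show ?case using k(1) by (intro exI[of _ "max k k'"]) auto
qed auto

text \<open>The change of variables \<open>moran\<close> reduces both bounds to
  \<open>f (moran x)\<close> on the unit interval. The infinite sum is the supremum of its finite
  partial sums: one good level suffices for the lower bound, and for the upper bound every finite
  set of frequencies lies in some level.\<close>

lemma moran_frame_bounds:
  fixes f :: "real \<Rightarrow> complex"
  assumes "f \<in> borel_measurable moran_measure" and "integrable moran_measure (\<lambda>x. (cmod (f x))\<^sup>2)"
  shows "ennreal (1/4 * (LINT x|moran_measure. (cmod (f x))\<^sup>2))
      \<le> (\<Sum>\<^sub>\<infinity>l\<in>moran_spectrum. ennreal ((cmod (fourier_coeff moran_measure f l))\<^sup>2))"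
    and "(\<Sum>\<^sub>\<infinity>l\<in>moran_spectrum. ennreal ((cmod (fourier_coeff moran_measure f l))\<^sup>2))
      \<le> ennreal (4 * (LINT x|moran_measure. (cmod (f x))\<^sup>2))"
proof -
  have m: "moran \<in> measurable unit_lborel borel"
    by (intro measurable_unit_lborel borel_measurable_moran)
  have fb [measurable]: "f \<in> borel_measurable borel"
    using assms(1) by (simp add: moran_measure_def)
  let ?F = "\<lambda>x. f (moran x)"
  let ?S = "\<lambda>k. \<Sum>l\<in>freq k. (cmod (LINT x|unit_lborel. ?F x * chi (real l * moran x)))\<^sup>2"
  have Fm: "?F \<in> borel_measurable borel" by measurable
  have F2: "integrable unit_lborel (\<lambda>x. (cmod (?F x))\<^sup>2)"
    using assms(2) unfolding moran_measure_def by (simp add: integrable_distr_eq[OF m])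
  have norm_eq: "(LINT x|moran_measure. (cmod (f x))\<^sup>2) = (LINT x|unit_lborel. (cmod (?F x))\<^sup>2)"
    unfolding moran_measure_def by (intro integral_distr m) measurable
  have coeff: "fourier_coeff moran_measure f (real l) = (LINT x|unit_lborel. ?F x * chi (real l * moran x))" for l
    unfolding fourier_coeff_chi moran_measure_def by (intro integral_distr m) measurable
  have sum_eq: "(\<Sum>l\<in>real ` freq k. ennreal ((cmod (fourier_coeff moran_measure f l))\<^sup>2)) = ennreal (?S k)" for k
    by (simp add: sum.reindex coeff)
  have inf_eq: "(\<Sum>\<^sub>\<infinity>l\<in>moran_spectrum. ennreal ((cmod (fourier_coeff moran_measure f l))\<^sup>2))
      = (SUP A\<in>{A. finite A \<and> A \<subseteq> moran_spectrum}. \<Sum>l\<in>A. ennreal ((cmod (fourier_coeff moran_measure f l))\<^sup>2))"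
    by (rule nonneg_infsum_complete) simp
  obtain k where k: "1/4 * (LINT x|unit_lborel. (cmod (?F x))\<^sup>2) \<le> ?S k"
    using sum_freq_moran_ge[OF Fm F2] by blast
  have "ennreal (1/4 * (LINT x|moran_measure. (cmod (f x))\<^sup>2))
      \<le> (\<Sum>l\<in>real ` freq k. ennreal ((cmod (fourier_coeff moran_measure f l))\<^sup>2))"
    unfolding norm_eq sum_eq using k by (rule ennreal_leI)
  also have "\<dots> \<le> (\<Sum>\<^sub>\<infinity>l\<in>moran_spectrum. ennreal ((cmod (fourier_coeff moran_measure f l))\<^sup>2))"
    unfolding inf_eq by (intro SUP_upper) (auto simp: moran_spectrum_def)
  finally show "ennreal (1/4 * (LINT x|moran_measure. (cmod (f x))\<^sup>2))
      \<le> (\<Sum>\<^sub>\<infinity>l\<in>moran_spectrum. ennreal ((cmod (fourier_coeff moran_measure f l))\<^sup>2))" .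
  show "(\<Sum>\<^sub>\<infinity>l\<in>moran_spectrum. ennreal ((cmod (fourier_coeff moran_measure f l))\<^sup>2))
      \<le> ennreal (4 * (LINT x|moran_measure. (cmod (f x))\<^sup>2))"
    unfolding inf_eq norm_eq
  proof (intro SUP_least, clarify)
    fix A assume "finite A" "A \<subseteq> moran_spectrum"
    then obtain k where k: "1 \<le> k" "A \<subseteq> real ` freq k" using finite_subset_moran_spectrum by blast
    have "(\<Sum>l\<in>A. ennreal ((cmod (fourier_coeff moran_measure f l))\<^sup>2)) \<le> ennreal (?S k)"
      unfolding sum_eq[symmetric] using k(2) by (intro sum_mono2) auto
    also have "\<dots> \<le> ennreal (4 * (LINT x|unit_lborel. (cmod (?F x))\<^sup>2))"
      by (intro ennreal_leI sum_freq_moran_le[OF Fm F2 k(1)])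
    finally show "(\<Sum>l\<in>A. ennreal ((cmod (fourier_coeff moran_measure f l))\<^sup>2))
        \<le> ennreal (4 * (LINT x|unit_lborel. (cmod (?F x))\<^sup>2))" .
  qed
qed

lemma frame_spectral_measure_moran: "frame_spectral_measure moran_measure moran_spectrum"
proof -
  have m: "moran \<in> measurable unit_lborel borel"
    by (intro measurable_unit_lborel borel_measurable_moran)
  have "sets moran_measure = sets borel" by (simp add: moran_measure_def)
  moreover have "finite_measure moran_measure"
    unfolding moran_measure_def
    by (intro finite_measure.finite_measure_distr finite_measure_unit_lborel m)
  moreover have "emeasure moran_measure UNIV \<noteq> 0"
    unfolding moran_measure_def using m by (simp add: emeasure_distr)
  moreover have "countable moran_spectrum" by (simp add: moran_spectrum_def)
  moreover have "(0::real) < 1/4" "(1/4::real) \<le> 4" by simp_all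
  ultimately show ?thesis unfolding frame_spectral_measure_def using moran_frame_bounds by blast
qed

theorem mainTheorem3:
  shows "\<exists>(M :: real measure) (\<Lambda> :: real set).
           frame_spectral_measure M \<Lambda> \<and>
           compact (measure_support M) \<and>
           hausdorff_dim (measure_support M) < beurling_dim \<Lambda>"
proof (intro exI conjI)
  show "frame_spectral_measure moran_measure moran_spectrum"
    by (rule frame_spectral_measure_moran)
  show "compact (measure_support moran_measure)"
    by (rule compact_moran_measure_support)
  have "ennreal (2/7) < ennreal (1/2)" by (subst ennreal_less_iff) auto
  then show "hausdorff_dim (measure_support moran_measure) < beurling_dim moran_spectrum"
    using hausdorff_dim_moran_support beurling_dim_moran_spectrum by (meson le_less_trans less_le_trans)
qed

end
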